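(* For every prime $p>2$, \[ \sum_{n=0}^{p-1}\frac{(-1)^n(28n^2+18n+3)}{2^{6n}}\binom{3n}{n}\binom{2n}{n}^4\equiv 0\pmod{p^2} \] and \[ \sum_{n=0}^{p-1} \frac{74n^2+27n+3}{2^{12n}}\binom{3n}{n}\binom{2n}{n}^4\equiv 0\pmod{p}. \]
   Context: For rational numbers $x,y$ and a prime $p$, $x\equiv y\pmod{p^r}$ means that $x-y$ is a rational number whose $p$-adic valuation is at least $r$. *)

theory Defs
  imports Complex_Main "HOL-Computational_Algebra.Primes"
begin

(* The p-adic valuation of a nonzero rational, computed on its reduced fraction.
   It yields 0 at x = 0, where the mathematical value is infinity; cong_rat
   below therefore treats x = y separately. *)
definition padic_val :: "nat \<Rightarrow> rat \<Rightarrow> int" where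
  "padic_val p x =
     int (multiplicity (int p) (fst (quotient_of x)))
     - int (multiplicity (int p) (snd (quotient_of x)))"

definition cong_rat :: "rat \<Rightarrow> rat \<Rightarrow> nat \<Rightarrow> nat \<Rightarrow> bool" where
  "cong_rat x y p r \<longleftrightarrow> x = y \<or> int r \<le> padic_val p (x - y)"

end

(* Both summands are the value at q = 0 of terms deformed by a parameter q through products such as
   (1^2 - q^2)(3^2 - q^2)...((2n-1)^2 - q^2). The deformed terms are members of Wilf-Zeilberger pairs
   obtained from Dougall's 5F4 sum, so their sums over n change under q -> q + 2 by a boundary term.
   For q = 2m + 1 the deformed terms vanish from n = m + 1 on, and so does the boundary term; hence
   the terminating sums are known exactly: 2q^2 for the first series and 0 for the second.
   At q = p the deformed terms are congruent to the original ones for n < p/2, modulo p^2 because the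
   first deformation is even in q, and modulo p for the second. For p/2 < n < p the fourth power of
   the central binomial coefficient is divisible by p^4. *)
theory Submission
  imports Defs
begin

section \<open>Two Wilf--Zeilberger pairs\<close>

text \<open>\<open>4^n\<close> times the rising factorials of length \<open>n\<close> at
  \<open>(1 - q)/2\<close> and \<open>(1 + q)/2\<close>. The factor with \<open>i = m\<close>
  vanishes at \<open>q = 2 * m + 1\<close>, which makes the sums terminate.\<close>

definition num_prod :: "nat \<Rightarrow> rat \<Rightarrow> rat" where
  "num_prod n q = (\<Prod>i<n. (2 * of_nat i + 1)^2 - q^2)"

text \<open>\<open>4^n\<close> times the rising factorials at \<open>1 - q/2\<close>,
  \<open>1 + q/2\<close>, \<open>1 - q\<close> and \<open>1 + q\<close>.\<close>

definition den_prod :: "nat \<Rightarrow> rat \<Rightarrow> rat" where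
  "den_prod n q = (\<Prod>i<n. (4 * (of_nat i + 1)^2 - q^2) * ((of_nat i + 1)^2 - q^2))"

definition term28 :: "nat \<Rightarrow> rat \<Rightarrow> rat" where
  "term28 n q = (-1)^n * fact (3 * n) * fact (2 * n) / (4^n * fact n ^ 3) * (num_prod n q / den_prod n q)
     * (28 * of_nat n ^ 2 + 18 * of_nat n + 3 - q^2)"

text \<open>The powers of \<open>q\<close> are grouped with the powers of \<open>2 * n + 1\<close>
  below them: at \<open>q = p\<close> and \<open>2 * n + 1 = p\<close> these quotients are still
  divisible by \<open>p\<close>.\<close>

definition term74 :: "nat \<Rightarrow> rat \<Rightarrow> rat" where
  "term74 n q = fact (3 * n) / (64^n * fact n ^ 3 * fact (2 * n) ^ 3) * num_prod n q ^ 3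
     * (74 * of_nat n ^ 2 + 27 * of_nat n + 3 - 6 * (5 * of_nat n + 1) * (q^2 / (2 * of_nat n + 1))
        + 3 * (3 * of_nat n + 1) * (q^4 / (2 * of_nat n + 1)^3))"

section \<open>Recurrences in \<open>n\<close> and the shift from \<open>q\<close> to
  \<open>q + 2\<close>\<close>

lemma num_prod_Suc: "num_prod (Suc n) q = num_prod n q * ((2 * of_nat n + 1)^2 - q^2)"
  by (simp add: num_prod_def)

lemma den_prod_Suc: "den_prod (Suc n) q = den_prod n q * ((4 * (of_nat n + 1)^2 - q^2) * ((of_nat n + 1)^2 - q^2))"
  by (simp add: den_prod_def)

text \<open>Under \<open>q -> q + 2\<close> the linear factors \<open>2 * i + 1 - q\<close> and
  \<open>2 * i + 1 + q\<close> move by one index in opposite directions, so that only end factors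
  survive in the quotient.\<close>

lemma num_prod_shift: "num_prod (Suc n) (q + 2) = - (q + 2 * of_nat n + 3) * (q + 2 * of_nat n + 1) * num_prod n q"
proof (induction n)
  case 0
  show ?case by (simp add: num_prod_def power2_eq_square algebra_simps)
next
  case (Suc n)
  show ?case
    unfolding num_prod_Suc[of "Suc n"] Suc num_prod_Suc[of n q] of_nat_Suc by algebra
qed

text \<open>The factors with \<open>q/2\<close> move by one index and those with \<open>q\<close> by
  two. The surviving end factors contain \<open>q^2\<close> and \<open>(q + 2)^2\<close>; this is
  the source of the normalisation of \<open>term28\<close> by \<open>q^2\<close>. The form without
  division also covers zeros of the products.\<close>

lemma den_prod_shift:
  "den_prod n (q + 2) * ((q + 2)^2 * (2 * of_nat n - q) * (of_nat n - q) * (of_nat n - 1 - q))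
   = - den_prod n q * (q^2 * (2 * of_nat n + 2 + q) * (of_nat n + q + 1) * (of_nat n + q + 2))"
proof (induction n)
  case 0
  show ?case by (simp add: den_prod_def power2_eq_square algebra_simps)
next
  case (Suc n)
  show ?case
    using Suc unfolding den_prod_Suc of_nat_Suc by algebra
qed

text \<open>The boundary terms contain \<open>fact (3 * n + 2)\<close>, so it serves as the common
  unit for term \<open>n + 1\<close> and for the boundary terms at \<open>n\<close> and
  \<open>n + 1\<close>. The next lemma does the same with \<open>fact (2 * n + 1)\<close>.\<close>

lemma fact_3_Suc:
  "(fact (3 * Suc n) :: rat) = 3 * (of_nat n + 1) * fact (3 * n + 2)"
  "(fact (3 * Suc n + 2) :: rat) = 3 * (of_nat n + 1) * (3 * of_nat n + 4) * (3 * of_nat n + 5) * fact (3 * n + 2)"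
proof -
  have "3 * Suc n = Suc (3 * n + 2)" "3 * Suc n + 2 = Suc (Suc (Suc (3 * n + 2)))" by simp_all
  then show "(fact (3 * Suc n) :: rat) = 3 * (of_nat n + 1) * fact (3 * n + 2)"
    "(fact (3 * Suc n + 2) :: rat) = 3 * (of_nat n + 1) * (3 * of_nat n + 4) * (3 * of_nat n + 5) * fact (3 * n + 2)"
    by (simp_all only: fact_Suc of_nat_Suc of_nat_add of_nat_mult) (simp_all add: algebra_simps)
qed

lemma fact_2_Suc:
  "(fact (2 * Suc n) :: rat) = 2 * (of_nat n + 1) * fact (2 * n + 1)"
  "(fact (2 * Suc n + 1) :: rat) = 2 * (of_nat n + 1) * (2 * of_nat n + 3) * fact (2 * n + 1)"
proof -
  have "2 * Suc n = Suc (2 * n + 1)" "2 * Suc n + 1 = Suc (Suc (2 * n + 1))" by simp_all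
  then show "(fact (2 * Suc n) :: rat) = 2 * (of_nat n + 1) * fact (2 * n + 1)"
    "(fact (2 * Suc n + 1) :: rat) = 2 * (of_nat n + 1) * (2 * of_nat n + 3) * fact (2 * n + 1)"
    by (simp_all only: fact_Suc of_nat_Suc of_nat_add of_nat_mult) (simp_all add: algebra_simps)
qed

lemma fact_Suc_rat: "(fact (Suc n) :: rat) = (of_nat n + 1) * fact n"
  by (simp add: add.commute)

text \<open>The right side is the Wilf-Zeilberger companion: its increment from \<open>N\<close> to
  \<open>N + 1\<close> is the summand at \<open>N + 1\<close>. It vanishes for odd \<open>q\<close>
  with \<open>0 < q < 2 * N\<close>, through \<open>num_prod N q\<close>.\<close>

lemma term74_telescope:
  "(\<Sum>n\<le>N. term74 n (q + 2) - term74 n q)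
   = 12 * fact (3 * N + 2) / (64^N * fact N ^ 3 * fact (2 * N + 1) ^ 3)
     * num_prod N q ^ 3 * (q + 2 * of_nat N + 1) ^ 3"
proof (induction N)
  case 0
  show ?case by (simp add: term74_def num_prod_def) algebra
next
  case (Suc N)
  define x :: rat where "x = of_nat N"
  define y where "y = 2 * x + 3"
  have x: "x + 1 \<noteq> 0" "y \<noteq> 0"
    unfolding x_def y_def using of_nat_0_le_iff[of N, where 'a = rat] by linarith+
  \<comment> \<open>Common factor of the boundary term at \<open>N\<close>, the two new summands and
    the boundary term at \<open>N + 1\<close>; each is \<open>u\<close> times a polynomial in
    \<open>x\<close> and \<open>q\<close>.\<close>
  define u where "u = fact (3 * N + 2) / (64^N * fact N ^ 3 * fact (2 * N + 1) ^ 3) * num_prod N q ^ 3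
    / (512 * (x + 1)^5 * y^3)"
  \<comment> \<open>With \<open>N + 1\<close>, \<open>64^N\<close> and the factorials as independent
    variables, \<open>coeff\<close> handles the coefficient of the new summand and
    \<open>coeff'\<close> that of the new boundary term.\<close>
  have coeff: "3 * X * f / (64 * c * (X * g)^3 * (2 * X * h)^3) = f / (c * g^3 * h^3) * 3 / (512 * X^5)"
    if "X \<noteq> 0" "c \<noteq> 0" "g \<noteq> 0" "h \<noteq> 0" for X f c g h :: rat
    using that by (simp add: divide_simps) algebra
  have coeff': "3 * X * a * b * f / (64 * c * (X * g)^3 * (2 * X * y * h)^3)
      = a * b * (f / (c * g^3 * h^3) * 3 / (512 * X^5 * y^3))"
    if "X \<noteq> 0" "c \<noteq> 0" "g \<noteq> 0" "h \<noteq> 0" for X a b f c g h :: rat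
    using that x by (simp add: divide_simps) algebra
  \<comment> \<open>One formula serves \<open>z = q\<close> and \<open>z = q + 2\<close>, since in
    both cases \<open>num_prod (Suc N) z\<close> is an explicit polynomial multiple of
    \<open>num_prod N q\<close>.\<close>
  have B: "term74 (Suc N) z = 3 * u * d^3 *
      (y^3 * (74 * (x + 1)^2 + 27 * (x + 1) + 3) - 6 * (5 * (x + 1) + 1) * z^2 * y^2
        + 3 * (3 * (x + 1) + 1) * z^4)" if "num_prod (Suc N) z = d * num_prod N q" for z d
  proof -
    have y: "2 * (x + 1) + 1 = y" by (simp add: y_def)
    have coeff: "fact (3 * Suc N) / (64^Suc N * fact (Suc N) ^ 3 * fact (2 * Suc N) ^ 3) * num_prod N q ^ 3
        = 3 * u * y^3"
      unfolding fact_3_Suc fact_2_Suc fact_Suc_rat x_def[symmetric] power_Suc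
      by (subst coeff) (use x in \<open>simp_all add: u_def\<close>)
    have P: "y^3 * (a - b * (s / y) + c * (t / y^3)) = y^3 * a - b * s * y^2 + c * t" for a b c s t
      using x by (simp add: field_simps power2_eq_square power3_eq_cube)
    have "term74 (Suc N) z = fact (3 * Suc N) / (64^Suc N * fact (Suc N) ^ 3 * fact (2 * Suc N) ^ 3)
        * num_prod N q ^ 3 * d ^ 3 * (74 * (x + 1)^2 + 27 * (x + 1) + 3
          - 6 * (5 * (x + 1) + 1) * (z^2 / (2 * (x + 1) + 1))
          + 3 * (3 * (x + 1) + 1) * (z^4 / (2 * (x + 1) + 1)^3))"
      unfolding term74_def that of_nat_Suc power_mult_distrib x_def add.commute[of 1] by (simp only: mult_ac)
    also have "\<dots> = 3 * u * d^3 * (y^3 * (74 * (x + 1)^2 + 27 * (x + 1) + 3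
          - 6 * (5 * (x + 1) + 1) * (z^2 / y) + 3 * (3 * (x + 1) + 1) * (z^4 / y^3)))"
      unfolding coeff y by (simp only: mult_ac)
    finally show ?thesis unfolding P .
  qed
  have "(\<Sum>n\<le>Suc N. term74 n (q + 2) - term74 n q)
      = 12 * (u * (512 * (x + 1)^5 * y^3)) * (q + 2 * x + 1)^3 + (term74 (Suc N) (q + 2) - term74 (Suc N) q)"
  proof -
    have "z / w * w = z" if "w \<noteq> 0" for z w :: rat using that by simp
    from this[of "512 * (x + 1)^5 * y^3"] have "fact (3 * N + 2) / (64^N * fact N ^ 3 * fact (2 * N + 1) ^ 3)
        * num_prod N q ^ 3 = u * (512 * (x + 1)^5 * y^3)"
      unfolding u_def using x by simp
    moreover have "12 * f / c * d * g = 12 * (f / c * d) * g" for f c d g :: rat by simp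
    ultimately show ?thesis
      unfolding sum.atMost_Suc Suc x_def[symmetric] by (simp only:)
  qed
  also have "term74 (Suc N) (q + 2) = 3 * u * (- (q + 2 * x + 3) * (q + 2 * x + 1))^3 *
      (y^3 * (74 * (x + 1)^2 + 27 * (x + 1) + 3) - 6 * (5 * (x + 1) + 1) * (q + 2)^2 * y^2
        + 3 * (3 * (x + 1) + 1) * (q + 2)^4)"
    by (rule B) (simp only: num_prod_shift x_def)
  also have "term74 (Suc N) q = 3 * u * ((2 * x + 1)^2 - q^2)^3 *
      (y^3 * (74 * (x + 1)^2 + 27 * (x + 1) + 3) - 6 * (5 * (x + 1) + 1) * q^2 * y^2
        + 3 * (3 * (x + 1) + 1) * q^4)"
    by (rule B) (simp only: num_prod_Suc x_def mult.commute)
  \<comment> \<open>The certificate of the pair: up to the factor \<open>u\<close>, a polynomial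
    identity in \<open>x\<close> and \<open>q\<close>.\<close>
  also have "12 * (u * (512 * (x + 1)^5 * y^3)) * (q + 2 * x + 1)^3
      + (3 * u * (- (q + 2 * x + 3) * (q + 2 * x + 1))^3 *
      (y^3 * (74 * (x + 1)^2 + 27 * (x + 1) + 3) - 6 * (5 * (x + 1) + 1) * (q + 2)^2 * y^2
        + 3 * (3 * (x + 1) + 1) * (q + 2)^4)
      - 3 * u * ((2 * x + 1)^2 - q^2)^3 *
      (y^3 * (74 * (x + 1)^2 + 27 * (x + 1) + 3) - 6 * (5 * (x + 1) + 1) * q^2 * y^2
        + 3 * (3 * (x + 1) + 1) * q^4))
      = 12 * ((3 * x + 4) * (3 * x + 5) * (3 * u)) * ((2 * x + 1)^2 - q^2)^3 * (q + 2 * x + 3)^3"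
    unfolding y_def by algebra
  also have "(3 * x + 4) * (3 * x + 5) * (3 * u)
      = fact (3 * Suc N + 2) / (64^Suc N * fact (Suc N) ^ 3 * fact (2 * Suc N + 1) ^ 3) * num_prod N q ^ 3"
    unfolding fact_3_Suc fact_2_Suc fact_Suc_rat power_Suc x_def[symmetric] y_def[symmetric]
    by (subst coeff') (use x in \<open>simp_all add: u_def\<close>)
  finally show ?case
    unfolding num_prod_Suc of_nat_Suc x_def by (simp add: power_mult_distrib add_ac mult_ac)
qed

text \<open>Here the step to \<open>q + 2\<close> telescopes only after division by \<open>q\<^sup>2\<close>; the non-vanishing
  assumptions keep the denominator \<open>den_prod N q\<close> away from zero.\<close>

lemma term28_telescope:
  assumes "q > 0" "\<And>n. n < N \<Longrightarrow> of_nat n + 1 \<noteq> q" "\<And>n. n < N \<Longrightarrow> 2 * (of_nat n + 1) \<noteq> q"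
  shows "(\<Sum>n\<le>N. term28 n (q + 2) / (q + 2)^2 - term28 n q / q^2)
   = - 6 * (-1)^N * fact (3 * N + 2) * fact (2 * N + 1) / (4^N * fact N ^ 3) * (num_prod N q / den_prod N q) / q^2
     * ((q + 1) * (q + 2 * of_nat N + 1)
         / ((q + 2 * of_nat N + 2) * (q + of_nat N + 1) * (q + of_nat N + 2)))"
  using assms(2,3)
proof (induction N)
  case 0
  have "q + 2 \<noteq> 0" "q + 1 \<noteq> 0" "q \<noteq> 0" using assms(1) by linarith+
  then show ?case by (simp add: term28_def num_prod_def den_prod_def divide_simps) algebra
next
  case (Suc N)
  define x :: rat where "x = of_nat N + 1"
  define e where "e = den_prod (Suc N) q"
  have "x > 0" unfolding x_def using of_nat_0_le_iff[of N, where 'a = rat] by linarith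
  with assms(1) have pos: "q \<noteq> 0" "q + 2 \<noteq> 0" "q + 1 \<noteq> 0" "x \<noteq> 0" "q + 2 * x + 2 \<noteq> 0"
      "q + x + 1 \<noteq> 0" "q + x + 2 \<noteq> 0" "q + 2 * x \<noteq> 0" "q + x \<noteq> 0"
    by linarith+
  \<comment> \<open>The last factor is \<open>N - q\<close>: for \<open>N = 0\<close> it is
    \<open>- q\<close>, and otherwise the hypothesis at index \<open>N - 1\<close> applies.\<close>
  have ne: "2 * x - q \<noteq> 0" "x - q \<noteq> 0" "x - 1 - q \<noteq> 0"
    using Suc.prems(1)[of N] Suc.prems(2)[of N] Suc.prems(1)[of "N - 1"] pos(1)
    by (cases N; simp add: x_def)+
  have "den_prod n q \<noteq> 0" if "n \<le> Suc N" for n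
  proof -
    have "4 * (of_nat i + 1)^2 - q^2 \<noteq> 0" "(of_nat i + 1)^2 - q^2 \<noteq> 0" if "i < n" for i
    proof -
      have i: "of_nat i + 1 - q \<noteq> 0" "2 * (of_nat i + 1) - q \<noteq> 0"
        using Suc.prems(1)[of i] Suc.prems(2)[of i] \<open>i < n\<close> \<open>n \<le> Suc N\<close> by simp_all
      have i': "of_nat i + 1 + q \<noteq> 0" "2 * (of_nat i + 1) + q \<noteq> 0"
        using assms(1) add_nonneg_pos[of "of_nat i + 1" q] add_nonneg_pos[of "2 * (of_nat i + 1)" q]
        by simp_all
      have "4 * (of_nat i + 1)^2 - q^2 = (2 * (of_nat i + 1) - q) * (2 * (of_nat i + 1) + q)"
        "(of_nat i + 1)^2 - q^2 = (of_nat i + 1 - q) * (of_nat i + 1 + q)"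
        by algebra+
      then show "4 * (of_nat i + 1)^2 - q^2 \<noteq> 0" "(of_nat i + 1)^2 - q^2 \<noteq> 0"
        using i i' by simp_all
    qed
    then show ?thesis by (simp add: den_prod_def)
  qed
  then have e: "e \<noteq> 0" by (simp add: e_def)
  define c where "c = (-1)^Suc N * fact (3 * Suc N) * fact (2 * Suc N) / (4^Suc N * fact (Suc N) ^ 3 :: rat)"
  \<comment> \<open>As with \<open>u\<close> above, the old boundary term and both new summands
    become \<open>w\<close> times polynomials; the last three factors are the denominator of the new
    boundary term.\<close>
  define w where "w = c * num_prod N q / (e * q^2 * ((q + 2 * x + 2) * (q + x + 1) * (q + x + 2)))"
  have c1: "(-1)^N * fact (3 * N + 2) * fact (2 * N + 1) / (4^N * fact N ^ 3) = - c * 2 * x / 3"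
    unfolding c_def fact_3_Suc fact_2_Suc fact_Suc_rat x_def[symmetric]
    using pos by (simp add: power_mult_distrib divide_simps) algebra
  have c2: "(-1)^Suc N * fact (3 * Suc N + 2) * fact (2 * Suc N + 1) / (4^Suc N * fact (Suc N) ^ 3)
      = c * (3 * x + 1) * (3 * x + 2) * (2 * x + 1)"
  proof -
    have "fact (3 * Suc N + 2) = (3 * x + 2) * (3 * x + 1) * (fact (3 * Suc N) :: rat)"
      "fact (2 * Suc N + 1) = (2 * x + 1) * (fact (2 * Suc N) :: rat)"
      unfolding fact_3_Suc fact_2_Suc x_def by algebra+
    then show ?thesis unfolding c_def by (simp only:) simp
  qed
  have "term28 (Suc N) z = c * (num_prod (Suc N) z / den_prod (Suc N) z) * (28 * x^2 + 18 * x + 3 - z^2)" for z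
    unfolding term28_def c_def x_def of_nat_Suc by (simp only: add.commute[of 1])
  note A = this
  have A1: "term28 (Suc N) q / q^2 = w * (((2 * x - 1)^2 - q^2) * (28 * x^2 + 18 * x + 3 - q^2)
      * ((q + 2 * x + 2) * (q + x + 1) * (q + x + 2)))"
  proof -
    have "num_prod (Suc N) q = num_prod N q * ((2 * x - 1)^2 - q^2)" unfolding num_prod_Suc x_def by algebra
    then show ?thesis unfolding A w_def e_def[symmetric] using pos e by (simp add: divide_simps)
  qed
  \<comment> \<open>The shift of \<open>den_prod\<close> contributes \<open>(q + 2)^2 / q^2\<close>;
    division by \<open>(q + 2)^2\<close> leaves the same \<open>1 / q^2\<close> that
    \<open>w\<close> contains.\<close>
  have A2: "term28 (Suc N) (q + 2) / (q + 2)^2 = w * ((q + 2 * x + 1) * (q + 2 * x - 1)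
      * ((2 * x - q) * (x - q) * (x - 1 - q)) * (28 * x^2 + 18 * x + 3 - (q + 2)^2))"
  proof -
    have D: "num_prod (Suc N) (q + 2) = - (q + 2 * x + 1) * (q + 2 * x - 1) * num_prod N q"
      unfolding num_prod_shift x_def by algebra
    have nz: "(q + 2)^2 * ((2 * x - q) * (x - q) * (x - 1 - q)) \<noteq> 0"
      using ne pos by simp
    have "den_prod (Suc N) (q + 2) * ((q + 2)^2 * ((2 * x - q) * (x - q) * (x - 1 - q)))
        = - e * q^2 * ((q + 2 * x + 2) * (q + x + 1) * (q + x + 2))"
      using den_prod_shift[of "Suc N" q] unfolding e_def of_nat_Suc x_def by algebra
    then have E: "den_prod (Suc N) (q + 2) = - e * q^2 * ((q + 2 * x + 2) * (q + x + 1) * (q + x + 2))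
        / ((q + 2)^2 * ((2 * x - q) * (x - q) * (x - 1 - q)))"
      by (simp only: nonzero_eq_divide_eq[OF nz])
    have *: "c * (- a * b * d / (- e * r * s / (t * l))) * y / t = c * d / (e * r * s) * (a * b * l * y)"
      if "r \<noteq> 0" "s \<noteq> 0" "t \<noteq> 0" "l \<noteq> 0" for a b d l r s t y :: rat
      using that e by (simp add: mult_ac)
    show ?thesis unfolding A w_def D E by (rule *) (use pos ne in simp_all)
  qed
  \<comment> \<open>In terms of \<open>x\<close> the old denominator is
    \<open>(q + 2 * x) * (q + x) * (q + x + 1)\<close>. Its first two factors cancel against factors
    of \<open>e / den_prod N q\<close>, which leaves \<open>2 * x - q\<close> and
    \<open>x - q\<close> in the numerator.\<close>
  have S1: "- 6 * (-1)^N * fact (3 * N + 2) * fact (2 * N + 1) / (4^N * fact N ^ 3) * (num_prod N q / den_prod N q) / q^2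
     * ((q + 1) * (q + 2 * of_nat N + 1)
         / ((q + 2 * of_nat N + 2) * (q + of_nat N + 1) * (q + of_nat N + 2)))
     = w * (4 * x * ((2 * x - q) * (x - q)) * (q + 1) * (q + 2 * x - 1) * ((q + 2 * x + 2) * (q + x + 2)))"
    (is "?l = _")
  proof -
    have "e = den_prod N q * ((4 * x^2 - q^2) * (x^2 - q^2))" unfolding e_def den_prod_Suc x_def ..
    also have "(4 * x^2 - q^2) * (x^2 - q^2) = ((2 * x - q) * (x - q)) * ((q + 2 * x) * (q + x))" by algebra
    finally have E: "den_prod N q = e / (((2 * x - q) * (x - q)) * ((q + 2 * x) * (q + x)))"
      using ne pos by (simp add: eq_divide_eq)
    have "?l = -6 * ((-1)^N * fact (3 * N + 2) * fact (2 * N + 1) / (4^N * fact N ^ 3)) * (num_prod N q / den_prod N q) / q^2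
     * ((q + 1) * (q + 2 * x - 1) / ((q + 2 * x) * (q + x) * (q + x + 1)))"
      unfolding x_def by (simp add: algebra_simps)
    also have "\<dots> = w * (4 * x * ((2 * x - q) * (x - q)) * (q + 1) * (q + 2 * x - 1) * ((q + 2 * x + 2) * (q + x + 2)))"
      unfolding c1 E w_def using pos e ne by (simp add: divide_simps)
    finally show ?thesis .
  qed
  have IH: "(\<Sum>n\<le>N. term28 n (q + 2) / (q + 2)^2 - term28 n q / q^2)
     = w * (4 * x * ((2 * x - q) * (x - q)) * (q + 1) * (q + 2 * x - 1) * ((q + 2 * x + 2) * (q + x + 2)))"
    unfolding S1[symmetric] by (rule Suc.IH) (use Suc.prems in simp_all)
  \<comment> \<open>The polynomial identity that certifies this pair, multiplied by
    \<open>w\<close>.\<close>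
  have "(\<Sum>n\<le>Suc N. term28 n (q + 2) / (q + 2)^2 - term28 n q / q^2)
     = w * (- 6 * (3 * x + 1) * (3 * x + 2) * (2 * x + 1) * ((2 * x - 1)^2 - q^2) * (q + 1) * (q + 2 * x + 1))"
    unfolding sum.atMost_Suc IH A1 A2 by algebra
  also have "\<dots> = - 6 * (c * (3 * x + 1) * (3 * x + 2) * (2 * x + 1)) * (num_prod N q * ((2 * x - 1)^2 - q^2) / e) / q^2
     * ((q + 1) * (q + 2 * x + 1) / ((q + 2 * x + 2) * (q + x + 1) * (q + x + 2)))"
  proof -
    have "c * d / (e * r * s) * (- 6 * k * l * m * b * g * h)
        = - 6 * (c * k * l * m) * (d * b / e) / r * (g * h / s)" for d r s k l m b g h :: rat
      by (simp add: mult_ac)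
    then show ?thesis unfolding w_def .
  qed
  also have "num_prod N q * ((2 * x - 1)^2 - q^2) = num_prod (Suc N) q" unfolding num_prod_Suc x_def by algebra
  finally have "(\<Sum>n\<le>Suc N. term28 n (q + 2) / (q + 2)^2 - term28 n q / q^2)
     = - 6 * (c * (3 * x + 1) * (3 * x + 2) * (2 * x + 1)) * (num_prod (Suc N) q / e) / q^2
     * ((q + 1) * (q + 2 * x + 1) / ((q + 2 * x + 2) * (q + x + 1) * (q + x + 2)))" .
  moreover have "- 6 * s * f * g / h * r / t * y = - 6 * (s * f * g / h) * r / t * y" for s f g h r t y :: rat
    by simp
  moreover have "of_nat (Suc N) = x" by (simp add: x_def)
  ultimately show ?case unfolding c2[symmetric] e_def by (simp only:)
qed

section \<open>Exact values of the terminating sums at odd \<open>q\<close>\<close>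

lemma num_prod_odd_eq_0: "num_prod (Suc m) (2 * of_nat m + 1) = 0"
  by (simp add: num_prod_Suc)

lemma term28_odd_eq_0: "term28 (Suc m) (2 * of_nat m + 1) = 0"
  by (simp add: term28_def num_prod_odd_eq_0)

lemma term74_odd_eq_0: "term74 (Suc m) (2 * of_nat m + 1) = 0"
  by (simp add: term74_def num_prod_odd_eq_0)

text \<open>The normalised sum does not depend on \<open>m\<close>: from
  \<open>q = 2 * m + 1\<close> to \<open>q + 2\<close> the boundary term at \<open>m + 1\<close>
  vanishes, and the extra summand at \<open>q\<close> is zero. Its value at \<open>m = 0\<close> is
  \<open>3 - 1 = 2\<close>.\<close>

lemma sum_term28_odd: "(\<Sum>n\<le>m. term28 n (2 * of_nat m + 1)) = 2 * (2 * of_nat m + 1)^2"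
proof -
  have "(\<Sum>n\<le>m. term28 n (2 * of_nat m + 1) / (2 * of_nat m + 1)^2) = 2"
  proof (induction m)
    case 0
    show ?case by (simp add: term28_def num_prod_def den_prod_def)
  next
    case (Suc m)
    show ?case
    proof (cases "m = 0") \<comment> \<open>for \<open>m = 0\<close> the factor \<open>1\<^sup>2 - q\<^sup>2\<close> of the denominator vanishes\<close>
      case True
      then show ?thesis
        by (simp add: term28_def num_prod_def den_prod_def fact_numeral)
    next
      case False
      define q :: rat where "q = 2 * of_nat m + 1"
      have q: "q = of_nat (2 * m + 1)" by (simp add: q_def)
      have "of_nat n + 1 \<noteq> q \<and> 2 * (of_nat n + 1) \<noteq> q" if "n < Suc m" for n
      proof -
        \<comment> \<open>The first holds by size, as \<open>n + 1 \<le> m + 1 < 2 * m + 1\<close>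
          for \<open>m > 0\<close>; the second by parity.\<close>
        have "n + 1 \<noteq> 2 * m + 1" "2 * (n + 1) \<noteq> 2 * m + 1" using False that by presburger+
        then have "(of_nat (n + 1) :: rat) \<noteq> of_nat (2 * m + 1)"
          "(of_nat (2 * (n + 1)) :: rat) \<noteq> of_nat (2 * m + 1)"
          unfolding of_nat_eq_iff .
        then show ?thesis unfolding q by simp
      qed
      moreover have "q > 0" unfolding q by simp
      ultimately have "(\<Sum>n\<le>Suc m. term28 n (q + 2) / (q + 2)^2 - term28 n q / q^2) = 0"
        by (subst term28_telescope) (simp_all add: num_prod_odd_eq_0 q_def)
      then have "(\<Sum>n\<le>Suc m. term28 n (q + 2) / (q + 2)^2) = (\<Sum>n\<le>Suc m. term28 n q / q^2)"
        by (simp only: sum_subtractf right_minus_eq)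
      also have "\<dots> = 2"
        using Suc by (simp add: term28_odd_eq_0 q_def)
      finally show ?thesis by (simp add: q_def add_ac)
    qed
  qed
  moreover have "(2 * of_nat m + 1 :: rat) \<noteq> 0"
    using of_nat_0_le_iff[of m, where 'a = rat] by linarith
  ultimately show ?thesis by (simp add: divide_eq_eq flip: sum_divide_distrib)
qed

text \<open>The same induction on \<open>m\<close>, without normalisation; the constant value is
  \<open>3 - 6 + 3 = 0\<close>, from \<open>m = 0\<close>.\<close>

lemma sum_term74_odd: "(\<Sum>n\<le>m. term74 n (2 * of_nat m + 1)) = 0"
proof (induction m)
  case 0
  show ?case by (simp add: term74_def num_prod_def)
next
  case (Suc m)
  define q :: rat where "q = 2 * of_nat m + 1"
  have "(\<Sum>n\<le>Suc m. term74 n (q + 2) - term74 n q) = 0"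
    by (subst term74_telescope) (simp add: num_prod_odd_eq_0 q_def)
  then have "(\<Sum>n\<le>Suc m. term74 n (q + 2)) = (\<Sum>n\<le>Suc m. term74 n q)"
    by (simp only: sum_subtractf right_minus_eq)
  also have "\<dots> = 0"
    using Suc by (simp add: term74_odd_eq_0 q_def)
  finally show ?case by (simp add: q_def add_ac)
qed

section \<open>The original summands as values at \<open>q = 0\<close>\<close>

lemma num_prod_0: "num_prod n 0 = (fact (2 * n) / (2^n * fact n))^2"
proof (induction n)
  case (Suc n)
  show ?case
    unfolding num_prod_Suc Suc fact_2_Suc fact_Suc_rat
    by (simp add: power_mult_distrib power_divide divide_simps) (simp add: power2_eq_square algebra_simps)
qed (simp add: num_prod_def)

lemma den_prod_0: "den_prod n 0 = 4^n * fact n ^ 4"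
proof (induction n)
  case (Suc n)
  show ?case
    unfolding den_prod_Suc Suc fact_Suc_rat by (simp add: power_mult_distrib)
qed (simp add: den_prod_def)

lemma choose_3_fact: "(of_nat ((3 * n) choose n) :: rat) = fact (3 * n) / (fact n * fact (2 * n))"
  using binomial_fact[of n "3 * n", where 'a = rat] by (simp add: mult_2)

lemma choose_2_fact: "(of_nat ((2 * n) choose n) :: rat) = fact (2 * n) / fact n ^ 2"
  using binomial_fact[of n "2 * n", where 'a = rat] by (simp add: power2_eq_square)

lemma term28_0: "term28 n 0 = ((-1)^n * (28 * of_nat n ^ 2 + 18 * of_nat n + 3) / 2 ^ (6 * n))
    * of_nat ((3 * n) choose n) * of_nat ((2 * n) choose n) ^ 4"
proof -
  \<comment> \<open>Here \<open>t\<close>, \<open>f\<close>, \<open>g\<close>, \<open>h\<close>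
    stand for \<open>2^n\<close>, \<open>fact n\<close>, \<open>fact (2 * n)\<close> and
    \<open>fact (3 * n)\<close>.\<close>
  have "s * h * g / (t^2 * f^3) * ((g / (t * f))^2 / (t^2 * f^4)) * (y - 0^2)
      = s * y / t^6 * (h / (f * g)) * (g / f^2)^4"
    if "t \<noteq> 0" "f \<noteq> 0" "g \<noteq> 0" for s t f g h y :: rat
    using that by (simp add: divide_simps) (simp add: eval_nat_numeral mult_ac)
  moreover have "(2::rat) ^ (6 * n) = (2^n)^6" "(4::rat)^n = (2^n)^2"
    by (simp_all add: power_mult[symmetric] mult.commute[of n]) (simp add: power_mult)
  ultimately show ?thesis
    unfolding term28_def num_prod_0 den_prod_0 choose_3_fact choose_2_fact by simp
qed

lemma term74_0: "term74 n 0 = ((74 * of_nat n ^ 2 + 27 * of_nat n + 3) / 2 ^ (12 * n))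
    * of_nat ((3 * n) choose n) * of_nat ((2 * n) choose n) ^ 4"
proof -
  have "h / (t^6 * f^3 * g^3) * ((g / (t * f))^2)^3 * y = y / t^12 * (h / (f * g)) * (g / f^2)^4"
    if "t \<noteq> 0" "f \<noteq> 0" "g \<noteq> 0" for t f g h y :: rat
    using that by (simp add: divide_simps) (simp add: eval_nat_numeral mult_ac)
  moreover have "(2::rat) ^ (12 * n) = (2^n)^12" "(64::rat)^n = (2^n)^6"
    by (simp_all add: power_mult[symmetric] mult.commute[of n]) (simp_all add: power_mult)
  ultimately show ?thesis
    unfolding term74_def num_prod_0 choose_3_fact choose_2_fact by simp
qed

section \<open>Divisibility in the localization at a prime\<close>

text \<open>\<open>padic_dvd p r x\<close> says that \<open>x\<close> lies in the ideal generated by \<open>p ^ r\<close> in the localization of the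
  integers at \<open>p\<close>.\<close>

definition padic_dvd :: "nat \<Rightarrow> nat \<Rightarrow> rat \<Rightarrow> bool" where
  "padic_dvd p r x \<longleftrightarrow> (\<exists>a b. \<not> int p dvd b \<and> x = of_int (int p ^ r * a) / of_int b)"

lemma padic_dvd_of_int: 
  assumes "prime p" "int p ^ r dvd a"
  shows "padic_dvd p r (of_int a)"
proof -
  obtain c where "a = int p ^ r * c" using assms(2) by (elim dvdE)
  moreover have "\<not> int p dvd 1" using assms(1) by (simp add: prime_nat_iff)
  ultimately show ?thesis unfolding padic_dvd_def by (intro exI[of _ c] exI[of _ 1]) simp
qed

lemma padic_dvd_0: "prime p \<Longrightarrow> padic_dvd p r 0"
  using padic_dvd_of_int[of p r 0] by simp

lemma padic_dvd_of_nat: "prime p \<Longrightarrow> p ^ r dvd a \<Longrightarrow> padic_dvd p r (of_nat a)"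
  using padic_dvd_of_int[of p r "int a"] by (simp flip: of_nat_power)

text \<open>Exponent 0 expresses \<open>p\<close>-integrality; together with
  \<open>padic_dvd_of_int\<close> this makes integers prime to \<open>p\<close> units.\<close>

lemma padic_dvd_inverse_of_int: "\<not> int p dvd b \<Longrightarrow> padic_dvd p 0 (inverse (of_int b))"
  unfolding padic_dvd_def by (intro exI[of _ 1] exI[of _ b]) (simp add: field_simps)

lemma padic_dvd_inverse_of_nat: "\<not> p dvd b \<Longrightarrow> padic_dvd p 0 (inverse (of_nat b))"
  using padic_dvd_inverse_of_int[of p "int b"] by simp

lemma padic_dvd_mult:
  assumes "prime p" "padic_dvd p r x" "padic_dvd p s y"
  shows "padic_dvd p (r + s) (x * y)"
proof -
  obtain a b c d where
    "\<not> int p dvd b" "x = of_int (int p ^ r * a) / of_int b"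
    "\<not> int p dvd d" "y = of_int (int p ^ s * c) / of_int d"
    using assms(2,3) unfolding padic_dvd_def by blast
  moreover from this have "\<not> int p dvd b * d"
    using assms(1) by (simp add: prime_dvd_mult_iff)
  ultimately show ?thesis
    unfolding padic_dvd_def by (intro exI[of _ "a * c"] exI[of _ "b * d"]) (simp add: power_add)
qed

lemma padic_dvd_mono:
  assumes "padic_dvd p r x" "s \<le> r"
  shows "padic_dvd p s x"
proof -
  obtain a b where "\<not> int p dvd b" "x = of_int (int p ^ r * a) / of_int b"
    using assms(1) unfolding padic_dvd_def by blast
  moreover have "int p ^ r * a = int p ^ s * (int p ^ (r - s) * a)"
    using assms(2) by (simp flip: power_add mult.assoc)
  ultimately show ?thesis unfolding padic_dvd_def by metis
qed

lemma padic_dvd_add: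
  assumes "prime p" "padic_dvd p r x" "padic_dvd p r y"
  shows "padic_dvd p r (x + y)"
proof -
  obtain a b c d where *:
    "\<not> int p dvd b" "x = of_int (int p ^ r * a) / of_int b"
    "\<not> int p dvd d" "y = of_int (int p ^ r * c) / of_int d"
    using assms(2,3) unfolding padic_dvd_def by blast
  from * have "\<not> int p dvd b * d" "b \<noteq> 0" "d \<noteq> 0"
    using assms(1) by (auto simp: prime_dvd_mult_iff)
  with * show ?thesis
    unfolding padic_dvd_def
    by (intro exI[of _ "a * d + c * b"] exI[of _ "b * d"]) (simp add: field_simps)
qed

lemma padic_dvd_mult_left: "prime p \<Longrightarrow> padic_dvd p 0 x \<Longrightarrow> padic_dvd p r y \<Longrightarrow> padic_dvd p r (x * y)"
  using padic_dvd_mult[of p 0 x r y] by simp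

lemma padic_dvd_mult_right: "prime p \<Longrightarrow> padic_dvd p r x \<Longrightarrow> padic_dvd p 0 y \<Longrightarrow> padic_dvd p r (x * y)"
  using padic_dvd_mult[of p r x 0 y] by simp

lemma padic_dvd_minus: "prime p \<Longrightarrow> padic_dvd p r x \<Longrightarrow> padic_dvd p r (- x)"
  using padic_dvd_mult_left[of p "- 1" r x] padic_dvd_of_int[of p 0 "- 1"] by simp

lemma padic_dvd_diff: "prime p \<Longrightarrow> padic_dvd p r x \<Longrightarrow> padic_dvd p r y \<Longrightarrow> padic_dvd p r (x - y)"
  using padic_dvd_add[of p r x "- y"] padic_dvd_minus[of p r y] by simp

lemma padic_dvd_sum:
  assumes "prime p" "\<And>i. i \<in> I \<Longrightarrow> padic_dvd p r (f i)"
  shows "padic_dvd p r (sum f I)"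
  using assms(2)
  by (induction I rule: infinite_finite_induct) (auto intro: padic_dvd_0 padic_dvd_add assms(1))

lemma padic_dvd_power: "prime p \<Longrightarrow> padic_dvd p 0 x \<Longrightarrow> padic_dvd p 0 (x ^ n)"
  by (induction n) (use padic_dvd_of_int[of p 0 1] in \<open>auto intro: padic_dvd_mult_left\<close>)

lemma padic_cong_mult:
  assumes "prime p" "padic_dvd p 0 x" "padic_dvd p 0 y'" "padic_dvd p r (x - x')" "padic_dvd p r (y - y')"
  shows "padic_dvd p r (x * y - x' * y')"
proof -
  have "x * y - x' * y' = x * (y - y') + (x - x') * y'" by (simp add: algebra_simps)
  with assms show ?thesis
    by (auto intro: padic_dvd_add padic_dvd_mult_left padic_dvd_mult_right)
qed

lemma padic_cong_prod:
  assumes "prime p" "finite I"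
    and "\<And>i. i \<in> I \<Longrightarrow> padic_dvd p 0 (f i) \<and> padic_dvd p 0 (g i) \<and> padic_dvd p r (f i - g i)"
  shows "padic_dvd p 0 (prod f I) \<and> padic_dvd p 0 (prod g I) \<and> padic_dvd p r (prod f I - prod g I)"
  using assms(2,3)
proof (induction I rule: finite_induct)
  case empty
  then show ?case
    using assms(1) padic_dvd_of_int[of p 0 1] by (auto intro: padic_dvd_0)
next
  case (insert i I)
  then show ?case
    using assms(1) by (auto intro!: padic_cong_mult padic_dvd_mult_left)
qed

text \<open>Since \<open>inverse 0 = 0\<close> counts as \<open>p\<close>-integral, integrality of
  the inverses does not exclude zero; this is assumed separately.\<close>

lemma padic_cong_inverse:
  assumes "prime p" "padic_dvd p 0 (inverse x)" "padic_dvd p 0 (inverse y)" "padic_dvd p r (x - y)"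
    and "x \<noteq> 0" "y \<noteq> 0"
  shows "padic_dvd p r (inverse x - inverse y)"
proof -
  have "inverse x - inverse y = inverse x * (- (x - y)) * inverse y"
    using assms(5,6) by (simp add: field_simps)
  with assms(1-4) show ?thesis
    by (auto intro: padic_dvd_mult_left padic_dvd_mult_right padic_dvd_minus simp del: minus_diff_eq)
qed

text \<open>Links the ideal to the valuation on reduced fractions. Cross-multiplication with the
  reduced fraction \<open>c / d\<close> gives \<open>c * b = p^r * a * d\<close>, and the
  multiplicities of \<open>p\<close> are compared, that of \<open>b\<close> being 0.\<close>

lemma cong_rat_0_if_padic_dvd:
  assumes "prime p" "padic_dvd p r x"
  shows "cong_rat x 0 p r"
proof (cases "x = 0")
  case False
  obtain a b where ab: "\<not> int p dvd b" "x = of_int (int p ^ r * a) / of_int b"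
    using assms(2) unfolding padic_dvd_def by blast
  obtain c d where cd: "quotient_of x = (c, d)" by fastforce
  have d: "d > 0" using quotient_of_denom_pos[OF cd] .
  have x: "x = of_int c / of_int d" using quotient_of_div[OF cd] .
  have nz: "a \<noteq> 0" "b \<noteq> 0" "c \<noteq> 0" using False ab x by auto
  have "of_int (c * b) = (of_int (int p ^ r * a * d) :: rat)"
    using ab(2) x nz d by (simp add: field_simps)
  then have eq: "c * b = int p ^ r * a * d" by (simp only: of_int_eq_iff)
  have p: "prime_elem (int p)" using assms(1) by auto
  then have p0: "int p \<noteq> 0" "\<not> is_unit (int p)" by (auto simp: prime_elem_def)
  have "multiplicity (int p) c + multiplicity (int p) b = multiplicity (int p) (c * b)"
    using p nz by (simp add: prime_elem_multiplicity_mult_distrib)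
  also have "\<dots> = r + multiplicity (int p) a + multiplicity (int p) d"
    unfolding eq using p p0 nz d by (simp add: prime_elem_multiplicity_mult_distrib multiplicity_same_power)
  finally have "int r \<le> int (multiplicity (int p) c) - int (multiplicity (int p) d)"
    using ab(1) by (simp add: not_dvd_imp_multiplicity_0)
  then show ?thesis by (simp add: cong_rat_def padic_val_def cd)
qed (simp add: cong_rat_def)

section \<open>Congruences for the deformed terms\<close>

text \<open>Applied with \<open>z = p\<close> for the deformed factors and \<open>z = 0\<close> for
  the original ones.\<close>

lemma not_dvd_square_diff:
  assumes "prime p" "0 < k" "k < p" "int p dvd z"
  shows "\<not> int p dvd (int k)^2 - z^2"
proof
  assume "int p dvd (int k)^2 - z^2"
  moreover have "int p dvd z^2" using assms(4) by (simp add: power2_eq_square)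
  ultimately have "int p dvd (int k)^2" using dvd_add[of "int p" "(int k)^2 - z^2" "z^2"] by simp
  then have "p dvd k" using assms(1) prime_dvd_power[of "int p" "int k" 2] by simp
  with assms(2,3) show False by (auto dest: dvd_imp_le)
qed

text \<open>Both differences are units at \<open>p\<close> and differ by \<open>p^2\<close>. The
  unevaluated \<open>0^2\<close> matches the factors of \<open>den_prod n 0\<close>, and the
  variable \<open>x\<close> admits \<open>4 * (i + 1)^2\<close> as a square.\<close>

lemma padic_dvd_inverse_square_diff:
  assumes "prime p" "0 < k" "k < p" "x = (of_nat k)^2"
  shows "padic_dvd p 0 (inverse (x - of_nat p ^ 2)) \<and> padic_dvd p 0 (inverse (x - 0^2))
    \<and> padic_dvd p 2 (inverse (x - of_nat p ^ 2) - inverse (x - 0^2))"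
proof -
  have *: "padic_dvd p 0 (inverse (x - of_int z ^ 2)) \<and> x - of_int z ^ 2 \<noteq> 0" if "int p dvd z" for z
  proof -
    have "\<not> int p dvd (int k)^2 - z^2" by (rule not_dvd_square_diff[OF assms(1-3) that])
    moreover from this have "(int k)^2 - z^2 \<noteq> 0" by auto
    moreover have "x - of_int z ^ 2 = of_int ((int k)^2 - z^2)" unfolding assms(4) by simp
    ultimately show ?thesis using padic_dvd_inverse_of_int[of p "(int k)^2 - z^2"]
      by (auto simp flip: of_int_power of_int_diff)
  qed
  have p: "padic_dvd p 0 (inverse (x - of_nat p ^ 2))" "x - of_nat p ^ 2 \<noteq> 0"
    and z: "padic_dvd p 0 (inverse (x - 0^2))" "x - 0^2 \<noteq> 0"
    using *[of "int p"] *[of 0] by simp_all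
  have "padic_dvd p 2 (of_int (- (int p ^ 2)))"
    by (rule padic_dvd_of_int[OF assms(1)]) simp
  then have "padic_dvd p 2 (inverse (x - of_nat p ^ 2) - inverse (x - 0^2))"
    by (intro padic_cong_inverse[OF assms(1) p(1) z(1) _ p(2) z(2)]) simp
  with p z show ?thesis by blast
qed

lemma padic_dvd_inverse_fact: "prime p \<Longrightarrow> n < p \<Longrightarrow> padic_dvd p 0 (inverse (fact n))"
  using padic_dvd_inverse_of_nat[of p "fact n"] by (simp add: prime_dvd_fact_iff)

lemma padic_dvd_inverse_power_2: "prime p \<Longrightarrow> p > 2 \<Longrightarrow> padic_dvd p 0 (inverse (2 ^ n))"
  using padic_dvd_inverse_of_nat[of p "2 ^ n"] prime_dvd_power[of p 2 n] dvd_imp_le[of p 2]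
  by auto

lemma padic_dvd_0_integer:
  assumes "prime p"
  shows "padic_dvd p 0 (of_nat k)" "padic_dvd p 0 (fact n)" "padic_dvd p 0 ((-1)^n)"
    "padic_dvd p 0 1" "padic_dvd p 0 (numeral w)"
  using padic_dvd_of_nat[OF assms, of 0 k] padic_dvd_of_nat[OF assms, of 0 "fact n"]
    padic_dvd_of_int[OF assms, of 0 "(-1)^n"] padic_dvd_of_nat[OF assms, of 0 1]
    padic_dvd_of_nat[OF assms, of 0 "numeral w"]
  by simp_all

lemmas padic_dvd_intros = padic_dvd_0_integer padic_dvd_power padic_dvd_add padic_dvd_diff
  padic_dvd_mult_left padic_dvd_0

lemma num_prod_cong:
  assumes "prime p"
  shows "padic_dvd p 0 (num_prod n (of_nat p)) \<and> padic_dvd p 0 (num_prod n 0) \<and> padic_dvd p 2 (num_prod n (of_nat p) - num_prod n 0)"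
  unfolding num_prod_def
proof (rule padic_cong_prod[OF assms finite_lessThan])
  fix i
  have "padic_dvd p 2 (- (of_nat p ^ 2))"
    using padic_dvd_of_int[OF assms, of 2 "- (int p ^ 2)"] by simp
  then show "padic_dvd p 0 ((2 * of_nat i + 1)^2 - of_nat p ^ 2)
      \<and> padic_dvd p 0 ((2 * of_nat i + 1)^2 - 0^2)
      \<and> padic_dvd p 2 ((2 * of_nat i + 1)^2 - of_nat p ^ 2 - ((2 * of_nat i + 1)^2 - 0^2))"
    using assms by (auto intro!: padic_dvd_intros)
qed

text \<open>For \<open>i < n\<close> both \<open>i + 1\<close> and \<open>2 * (i + 1)\<close> lie
  strictly between 0 and \<open>p\<close>, so every factor is a unit at \<open>p\<close>.\<close>

lemma den_prod_inverse_cong: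
  assumes "prime p" "2 * n < p"
  shows "padic_dvd p 0 (inverse (den_prod n (of_nat p))) \<and> padic_dvd p 0 (inverse (den_prod n 0))
    \<and> padic_dvd p 2 (inverse (den_prod n (of_nat p)) - inverse (den_prod n 0))"
  unfolding den_prod_def prod_inversef[symmetric] inverse_mult_distrib o_def
proof (rule padic_cong_prod[OF assms(1) finite_lessThan])
  fix i
  assume "i \<in> {..<n}"
  then have i: "0 < 2 * (i + 1)" "2 * (i + 1) < p" "0 < i + 1" "i + 1 < p" using assms(2) by auto
  have "(4 * (of_nat i + 1)^2 :: rat) = of_nat (2 * (i + 1)) ^ 2" "(of_nat i + 1)^2 = (of_nat (i + 1) ^ 2 :: rat)"
    by (simp_all add: power2_eq_square algebra_simps)
  note padic_dvd_inverse_square_diff[OF assms(1) i(1,2) this(1)]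
    padic_dvd_inverse_square_diff[OF assms(1) i(3,4) this(2)]
  then show "padic_dvd p 0 (inverse (4 * (of_nat i + 1)^2 - of_nat p ^ 2) * inverse ((of_nat i + 1)^2 - of_nat p ^ 2))
      \<and> padic_dvd p 0 (inverse (4 * (of_nat i + 1)^2 - 0^2) * inverse ((of_nat i + 1)^2 - 0^2))
      \<and> padic_dvd p 2 (inverse (4 * (of_nat i + 1)^2 - of_nat p ^ 2) * inverse ((of_nat i + 1)^2 - of_nat p ^ 2)
        - inverse (4 * (of_nat i + 1)^2 - 0^2) * inverse ((of_nat i + 1)^2 - 0^2))"
    by (intro conjI padic_cong_mult padic_dvd_mult_left assms(1)) blast+
qed

text \<open>The parameter enters through three factors, each congruent modulo \<open>p^2\<close> to
  its value at \<open>q = 0\<close>; the rest is \<open>p\<close>-integral, as \<open>fact n\<close>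
  and powers of 2 are prime to \<open>p\<close>.\<close>

lemma term28_cong:
  assumes "prime p" "p > 2" "2 * n < p"
  shows "padic_dvd p 2 (term28 n (of_nat p) - term28 n 0)"
proof -
  define c :: rat where
    "c = (-1)^n * fact (3 * n) * fact (2 * n) * inverse (2^(2 * n)) * inverse (fact n) ^ 3"
  define y :: rat where "y = 28 * of_nat n ^ 2 + 18 * of_nat n + 3"
  have A: "term28 n q = c * (num_prod n q * inverse (den_prod n q) * (y - q^2))" for q
    unfolding term28_def c_def y_def by (simp add: divide_inverse power_mult power_inverse)
  have c: "padic_dvd p 0 c"
    unfolding c_def using assms
    by (auto intro!: padic_dvd_intros padic_dvd_inverse_fact padic_dvd_inverse_power_2)
  have y: "padic_dvd p 0 (y - 0^2)"
    unfolding y_def using assms(1) by (auto intro!: padic_dvd_intros)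
  have "padic_dvd p 2 (- (of_nat p ^ 2))"
    using padic_dvd_of_int[OF assms(1), of 2 "- (int p ^ 2)"] by simp
  then have y2: "padic_dvd p 2 (y - of_nat p ^ 2 - (y - 0^2))"
    by simp
  have "padic_dvd p 2 (num_prod n (of_nat p) * inverse (den_prod n (of_nat p)) * (y - of_nat p ^ 2)
      - num_prod n 0 * inverse (den_prod n 0) * (y - 0^2))"
    using num_prod_cong[OF assms(1)] den_prod_inverse_cong[OF assms(1,3)] y y2
    by (intro padic_cong_mult padic_dvd_mult_left assms(1)) auto
  then show ?thesis
    unfolding A right_diff_distrib[symmetric] by (intro padic_dvd_mult_left assms(1) c)
qed

text \<open>From \<open>2 * n + 1 \<le> p\<close> it follows that \<open>p / (2 * n + 1)\<close> is
  \<open>p\<close>-integral. For \<open>2 * n + 1 = p\<close> both quotients equal \<open>p\<close>,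
  so exponent 1 is the best possible.\<close>

lemma padic_dvd_power_div_odd:
  assumes "prime p" "2 * n < p"
  shows "padic_dvd p 1 (of_nat p ^ 2 / (2 * of_nat n + 1))"
    "padic_dvd p 1 (of_nat p ^ 4 / (2 * of_nat n + 1) ^ 3)"
proof -
  define x :: rat where "x = of_nat p / (2 * of_nat n + 1)"
  have x: "padic_dvd p 0 x"
  proof (cases "2 * n + 1 = p")
    case True
    then have "x = 1" unfolding x_def by (metis of_nat_1 of_nat_add of_nat_mult of_nat_numeral
        assms(1) divide_self of_nat_eq_0_iff not_prime_0)
    then show ?thesis using padic_dvd_0_integer(4)[OF assms(1)] by simp
  next
    case False
    then have "\<not> p dvd 2 * n + 1" using assms(2) by (auto dest: dvd_imp_le)
    from padic_dvd_inverse_of_nat[OF this] show ?thesis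
      unfolding x_def divide_inverse using assms(1)
      by (auto intro!: padic_dvd_intros simp: add_ac)
  qed
  have p: "padic_dvd p 1 (of_nat p)"
    using padic_dvd_of_nat[OF assms(1), of 1 p] by simp
  have "of_nat p ^ 2 / (2 * of_nat n + 1) = x * of_nat p"
    "of_nat p ^ 4 / (2 * of_nat n + 1) ^ 3 = x ^ 3 * of_nat p"
    unfolding x_def by (simp_all add: power2_eq_square power_divide eval_nat_numeral)
  then show "padic_dvd p 1 (of_nat p ^ 2 / (2 * of_nat n + 1))"
    "padic_dvd p 1 (of_nat p ^ 4 / (2 * of_nat n + 1) ^ 3)"
    using x p assms(1) by (auto intro!: padic_dvd_mult_left padic_dvd_power)
qed

lemma term74_cong:
  assumes "prime p" "p > 2" "2 * n < p"
  shows "padic_dvd p 1 (term74 n (of_nat p) - term74 n 0)"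
proof -
  define c :: rat where
    "c = fact (3 * n) * inverse (2^(6 * n)) * inverse (fact n) ^ 3 * inverse (fact (2 * n)) ^ 3"
  define y :: rat where "y = 74 * of_nat n ^ 2 + 27 * of_nat n + 3"
  \<comment> \<open>The part of the last factor of \<open>term74\<close> that depends on
    \<open>q\<close>, at \<open>q = p\<close>; it is divisible by \<open>p\<close>.\<close>
  define z :: rat where "z = 3 * (3 * of_nat n + 1) * (of_nat p ^ 4 / (2 * of_nat n + 1) ^ 3)
    - 6 * (5 * of_nat n + 1) * (of_nat p ^ 2 / (2 * of_nat n + 1))"
  have B: "term74 n (of_nat p) = c * (num_prod n (of_nat p) ^ 3 * (y + z))" "term74 n 0 = c * (num_prod n 0 ^ 3 * y)"
    unfolding term74_def c_def y_def z_def
    by (simp_all add: divide_inverse power_mult power_inverse)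
  have c: "padic_dvd p 0 c"
    unfolding c_def using assms
    by (auto intro!: padic_dvd_intros padic_dvd_inverse_fact padic_dvd_inverse_power_2)
  have y: "padic_dvd p 0 y"
    unfolding y_def using assms(1) by (auto intro!: padic_dvd_intros)
  have z: "padic_dvd p 1 z"
    unfolding z_def using assms(1) padic_dvd_power_div_odd[OF assms(1,3)]
    by (intro padic_dvd_diff padic_dvd_mult_left padic_dvd_intros) auto
  have D: "padic_dvd p 0 (num_prod n (of_nat p))" "padic_dvd p 0 (num_prod n 0)"
    "padic_dvd p 1 (num_prod n (of_nat p) - num_prod n 0)"
    using num_prod_cong[OF assms(1), of n] padic_dvd_mono[of p 2 _ 1] by auto
  have "padic_dvd p 1 (num_prod n (of_nat p) ^ 3 * (y + z) - num_prod n 0 ^ 3 * y)"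
    unfolding power3_eq_cube using assms(1) D y z
    by (intro padic_cong_mult padic_dvd_mult_left) auto
  then show ?thesis
    unfolding B right_diff_distrib[symmetric] by (intro padic_dvd_mult_left assms(1) c)
qed

text \<open>The prime divides \<open>fact (2 * n)\<close> but not \<open>fact n\<close>, hence it
  divides the central binomial coefficient.\<close>

lemma padic_dvd_choose_power:
  assumes "prime p" "n < p" "p \<le> 2 * n" "r \<le> 4"
  shows "padic_dvd p r (of_nat ((2 * n) choose n) ^ 4)"
proof -
  have "fact n * fact n * ((2 * n) choose n) = fact (2 * n)"
    using binomial_fact_lemma[of n "2 * n"] by simp
  moreover have "p dvd fact (2 * n)" "\<not> p dvd fact n"
    using assms by (simp_all add: prime_dvd_fact_iff)
  ultimately have "p dvd ((2 * n) choose n)"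
    using assms(1) by (metis prime_dvd_mult_iff)
  then have "p ^ r dvd ((2 * n) choose n) ^ 4"
    using assms(4) by (meson dvd_power_same dvd_trans le_imp_power_dvd)
  from padic_dvd_of_nat[OF assms(1) this] show ?thesis by simp
qed

lemma padic_dvd_term28:
  assumes "prime p" "p > 2" "n < p" "p \<le> 2 * n"
  shows "padic_dvd p 2 (term28 n 0)"
  unfolding term28_0 divide_inverse using assms
  by (intro padic_dvd_mult_left[OF assms(1)] padic_dvd_choose_power padic_dvd_inverse_power_2
      padic_dvd_intros) auto

lemma padic_dvd_term74:
  assumes "prime p" "p > 2" "n < p" "p \<le> 2 * n"
  shows "padic_dvd p 1 (term74 n 0)"
  unfolding term74_0 divide_inverse using assms
  by (intro padic_dvd_mult_left[OF assms(1)] padic_dvd_choose_power padic_dvd_inverse_power_2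
      padic_dvd_intros) auto

text \<open>Splits the range at \<open>m\<close>: there \<open>f\<close>, the deformed terms,
  replaces \<open>g\<close>, the original ones; beyond \<open>m\<close> each \<open>g n\<close> is
  divisible on its own.\<close>

lemma padic_dvd_truncated_sum:
  assumes "prime p" "p = 2 * m + 1"
    and "\<And>n. 2 * n < p \<Longrightarrow> padic_dvd p r (f n - g n)"
    and "\<And>n. n < p \<Longrightarrow> p \<le> 2 * n \<Longrightarrow> padic_dvd p r (g n)"
    and "padic_dvd p r (\<Sum>n\<le>m. f n)"
  shows "padic_dvd p r (\<Sum>n = 0..p - 1. g n)"
proof -
  have "{0..p - 1} = {..m} \<union> {m<..p - 1}" using assms(2) by auto
  then have "(\<Sum>n = 0..p - 1. g n) = (\<Sum>n\<le>m. g n) + (\<Sum>n\<in>{m<..p - 1}. g n)"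
    by (simp add: sum.union_disjoint ivl_disj_int)
  also have "(\<Sum>n\<le>m. g n) = (\<Sum>n\<le>m. f n) - (\<Sum>n\<le>m. f n - g n)"
    by (simp add: sum_subtractf)
  also have "padic_dvd p r (\<dots> + (\<Sum>n\<in>{m<..p - 1}. g n))"
    by (intro padic_dvd_add padic_dvd_diff assms(1,5); rule padic_dvd_sum[OF assms(1)])
      (use assms(2-4) in auto)
  finally show ?thesis .
qed

theorem theorem2:
  fixes p :: nat
  assumes "prime p" and "p > 2"
  shows "cong_rat
           (\<Sum>n = 0..p - 1.
              ((-1) ^ n * (28 * of_nat n ^ 2 + 18 * of_nat n + 3) / 2 ^ (6 * n))
                * of_nat ((3 * n) choose n) * of_nat ((2 * n) choose n) ^ 4)
           0 p 2
       \<and> cong_rat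
           (\<Sum>n = 0..p - 1.
              ((74 * of_nat n ^ 2 + 27 * of_nat n + 3) / 2 ^ (12 * n))
                * of_nat ((3 * n) choose n) * of_nat ((2 * n) choose n) ^ 4)
           0 p 1"
proof -
  have "odd p" using assms prime_odd_nat by auto
  then obtain m where m: "p = 2 * m + 1" by (rule oddE)
  \<comment> \<open>The exact values at \<open>q = 2 * m + 1 = p\<close>; the first is visibly
    divisible by \<open>p^2\<close>.\<close>
  have "(\<Sum>n\<le>m. term28 n (of_nat p)) = of_nat (p^2 * 2)" "(\<Sum>n\<le>m. term74 n (of_nat p)) = 0"
    using sum_term28_odd[of m] sum_term74_odd[of m] by (simp_all add: m add_ac)
  moreover have "padic_dvd p 2 (of_nat (p^2 * 2))"
    using assms(1) by (rule padic_dvd_of_nat) simp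
  ultimately have sums: "padic_dvd p 2 (\<Sum>n\<le>m. term28 n (of_nat p))" "padic_dvd p 1 (\<Sum>n\<le>m. term74 n (of_nat p))"
    using padic_dvd_0[OF assms(1)] by simp_all
  have "padic_dvd p 2 (\<Sum>n = 0..p - 1. term28 n 0)"
    using assms by (intro padic_dvd_truncated_sum[OF assms(1) m _ _ sums(1)] term28_cong padic_dvd_term28)
  moreover have "padic_dvd p 1 (\<Sum>n = 0..p - 1. term74 n 0)"
    using assms by (intro padic_dvd_truncated_sum[OF assms(1) m _ _ sums(2)] term74_cong padic_dvd_term74)
  ultimately show ?thesis
    unfolding term28_0[symmetric] term74_0[symmetric] by (intro conjI cong_rat_0_if_padic_dvd[OF assms(1)])
qed

end
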